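(* Let $q\ge 6$ be a prime power, let $\mathcal V$ be a ruled quintic surface of $\mathrm{PG}(6,q)$, let $r\in\{3,4,5\}$ and let $\mathcal N_r$ be an $r$-dim nrc contained in $\mathcal V$. Then $\mathcal N_r$ contains exactly one point on each generator of $\mathcal V$.
   Context: Construction: in $\mathrm{PG}(6,q)$ let $\alpha$ be a plane and $\Pi_3$ a $3$-space with $\alpha\cap\Pi_3=\emptyset$. Let $\mathcal C$ be a non-degenerate conic in $\alpha$ and $\mathcal N_3$ a twisted cubic in $\Pi_3$, parametrised as $\mathcal C=\{(1,\theta,\theta^2)\}$ and $\mathcal N_3=\{(1,\epsilon,\epsilon^2,\epsilon^3)\}$ ($\theta,\epsilon\in\mathbb F_q\cup\{\infty\}$), and let $\phi\in\mathrm{PGL}(2,q)$ act on parameters, giving a bijection $\mathcal C\to\mathcal N_3$. The ruled quintic surface $\mathcal V$ is the set of points on the $q+1$ lines (generators) joining each point of $\mathcal C$ to its image under $\phi$. An $r$-dim nrc is a normal rational curve spanning an $r$-dimensional subspace. *)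

theory Defs
  imports "HOL-Analysis.Cartesian_Space"
begin

text \<open>
  The points of the projective space over the field \<open>F\<close> attached to a vector space \<open>F\<^sup>n\<close> are its
  one-dimensional linear subspaces; a projective \<open>k\<close>-space is a linear subspace of (vector space)
  dimension \<open>k + 1\<close>, and a point \<open>P\<close> lies on a subspace \<open>U\<close> iff \<open>P \<subseteq> U\<close>.
  So \<open>PG(6, q)\<close> is modelled on \<open>'a ^ 7\<close> where \<open>'a\<close> is a finite field with \<open>q\<close> elements.
\<close>

definition proj_subspace :: "nat \<Rightarrow> ('a::field ^ 'n) set \<Rightarrow> bool" where
  "proj_subspace k U \<longleftrightarrow> vec.subspace U \<and> vec.dim U = k + 1"

definition points_on :: "('a::field ^ 'n) set \<Rightarrow> ('a ^ 'n) set set" where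
  "points_on U = {P. proj_subspace 0 P \<and> P \<subseteq> U}"

definition coordinate_basis :: "nat \<Rightarrow> (nat \<Rightarrow> 'a::field ^ 'n) \<Rightarrow> ('a ^ 'n) set \<Rightarrow> bool" where
  "coordinate_basis r b U \<longleftrightarrow>
     inj_on b {..r} \<and> vec.independent (b ` {..r}) \<and> vec.span (b ` {..r}) = U"

text \<open>
  The parameters \<open>F\<^sub>q \<union> {\<infinity>}\<close> are \<open>'a option\<close> with \<open>None\<close> as \<open>\<infinity>\<close>. In coordinates with respect to
  \<open>b 0, \<dots>, b r\<close> the point with parameter \<open>t\<close> is \<open>(1, t, \<dots>, t\<^sup>r)\<close>, and \<open>\<infinity>\<close> gives \<open>(0, \<dots>, 0, 1)\<close>.
\<close>

definition nrc_point :: "nat \<Rightarrow> (nat \<Rightarrow> 'a::field ^ 'n) \<Rightarrow> 'a option \<Rightarrow> ('a ^ 'n) set" where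
  "nrc_point r b \<theta> =
     (case \<theta> of None \<Rightarrow> vec.span {b r} | Some t \<Rightarrow> vec.span {\<Sum>i\<le>r. t ^ i *s b i})"

definition dim_nrc :: "nat \<Rightarrow> ('a::field ^ 'n) set set \<Rightarrow> bool" where
  "dim_nrc r N \<longleftrightarrow>
     (\<exists>U b. proj_subspace r U \<and> coordinate_basis r b U \<and>
            N = range (nrc_point r b) \<and> vec.span (\<Union>N) = U)"

definition moebius :: "'a::field \<Rightarrow> 'a \<Rightarrow> 'a \<Rightarrow> 'a \<Rightarrow> 'a option \<Rightarrow> 'a option" where
  "moebius a b c d \<theta> =
     (case \<theta> of
        None \<Rightarrow> if c = 0 then None else Some (a / c)
      | Some t \<Rightarrow> if c * t + d = 0 then None else Some ((a * t + b) / (c * t + d)))"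

definition PGL2 :: "('a::field option \<Rightarrow> 'a option) set" where
  "PGL2 = {moebius a b c d |a b c d. a * d - b * c \<noteq> 0}"

text \<open>
  \<open>G\<close> is the set of generators. The conic and the twisted cubic are the ranges of \<open>nrc_point 2 a\<close>
  and \<open>nrc_point 3 b\<close>; disjointness of the plane \<open>\<alpha>\<close> and the 3-space \<open>S\<close> means that they meet only
  in the zero vector.
\<close>

definition ruled_quintic_surface ::
    "('a::field ^ 7) set set \<Rightarrow> ('a ^ 7) set set \<Rightarrow> bool" where
  "ruled_quintic_surface V G \<longleftrightarrow>
     (\<exists>\<alpha> S a b \<phi>.
        proj_subspace 2 \<alpha> \<and> proj_subspace 3 S \<and> \<alpha> \<inter> S = {0} \<and>
        coordinate_basis 2 a \<alpha> \<and> coordinate_basis 3 b S \<and> \<phi> \<in> PGL2 \<and>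
        G = {vec.span (nrc_point 2 a \<theta> \<union> nrc_point 3 b (\<phi> \<theta>)) |\<theta>. True} \<and>
        V = (\<Union>g\<in>G. points_on g))"

end

theory Submission
  imports Defs "HOL-Computational_Algebra.Polynomial"
begin

text \<open>
  Suppose a generator meets \<open>N\<close> in two points, and let \<open>U\<close> be the span of \<open>N\<close>. After a change of
  parameter the bijection between conic and cubic is the identity and the generator has parameter
  \<open>0\<close>. A linear form restricts to the generator with parameter \<open>t\<close> as a pair of polynomials in \<open>t\<close>
  of degrees at most 2 and 3. If the form vanishes on \<open>U\<close>, it vanishes on the generator \<open>0\<close>, so both
  polynomials are divisible by \<open>t\<close>; the quotients define another linear form, which vanishes at the
  at least \<open>q - 1\<close> points of \<open>N\<close> off that generator. A form that does not vanish on \<open>U\<close> has at most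
  \<open>r\<close> zeros on \<open>N\<close>, and \<open>q - 1 > r\<close> since \<open>q \<ge> 7\<close> (there is no field with 6 elements), so the
  new form vanishes on \<open>U\<close> as well. Iterating, the original polynomials are divisible by every power
  of \<open>t\<close>, hence zero; but \<open>U\<close> is a proper subspace, so a nonzero form vanishing on it exists. Thus
  a generator carries at most one point of \<open>N\<close>, and there are as many generators as points.
\<close>

subsection \<open>Fields with six elements\<close>

text \<open>Multiplication by a nonzero \<open>x\<close> permutes the nonzero elements; comparing
  their products gives exponent \<open>q - 1\<close>, and one more factor covers 0 as well.\<close>

lemma finite_field_power_card_eq_same:
  fixes x :: "'a::{field,finite}"
  shows "x ^ CARD('a) = x"
proof (cases "x = 0")
  case True
  then show ?thesis by simp
next
  case False
  let ?A = "UNIV - {0 :: 'a}"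
  have "bij_betw ((*) x) ?A ?A"
    by (rule bij_betwI[where g = "\<lambda>y. y / x"]) (use False in auto)
  then have "(\<Prod>y\<in>?A. x * y) = \<Prod>?A"
    by (rule prod.reindex_bij_betw[where g = "\<lambda>y. y"])
  moreover have "\<Prod>?A \<noteq> 0" by simp
  ultimately have "x ^ card ?A = 1" by (simp add: prod.distrib)
  moreover have "CARD('a) = Suc (card ?A)"
    by (rule card_Suc_Diff1[symmetric]) simp_all
  ultimately show ?thesis by (simp only: power_Suc mult_1_right)
qed

text \<open>Translation by 1 permutes the field, so the sum of all elements absorbs \<open>q\<close>
  copies of 1.\<close>

lemma finite_field_of_nat_card: "of_nat CARD('a) = (0 :: 'a::{field,finite})"
proof -
  have "bij_betw ((+) 1) (UNIV :: 'a set) UNIV"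
    by (rule bij_betwI[where g = "\<lambda>y. y - 1"]) auto
  then have "(\<Sum>y\<in>UNIV. 1 + y) = (\<Sum>y\<in>UNIV. y :: 'a)"
    by (rule sum.reindex_bij_betw[where g = "\<lambda>y. y"])
  then show ?thesis by (simp add: sum.distrib)
qed

text \<open>Comparing \<open>(x + 1)\<^sup>6 = x + 1\<close> with \<open>x\<^sup>6 = x\<close> leaves \<open>x\<^sup>2 (x + 1)\<^sup>2 = 0\<close> in characteristic 2
  and \<open>2 x\<^sup>3 = 0\<close> in characteristic 3.\<close>

lemma finite_field_card_ne_6: "CARD('a::{field,finite}) \<noteq> 6"
proof
  assume card: "CARD('a) = 6"
  have pow: "x ^ 6 = x" for x :: 'a
    using finite_field_power_card_eq_same[of x] card by simp
  have six: "(2 :: 'a) * 3 = 0"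
    using finite_field_of_nat_card[where 'a = 'a] card by simp
  have expand: "6 * x ^ 5 + 15 * x ^ 4 + 20 * x ^ 3 + 15 * x ^ 2 + 6 * x = 0" for x :: 'a
  proof -
    have "(x + 1) ^ 6 = x ^ 6 + 6 * x ^ 5 + 15 * x ^ 4 + 20 * x ^ 3 + 15 * x ^ 2 + 6 * x + 1"
      by algebra
    then show ?thesis using pow[of x] pow[of "x + 1"] by (simp add: add_ac)
  qed
  \<comment> \<open>Since \<open>2 * 3 = 0\<close>, one of the factors vanishes. The polynomial
    subtracted in each case is a multiple of that factor, chosen to leave a perfect square or a
    single monomial.\<close>
  have "x \<in> {0, 1}" for x :: 'a
  proof (cases "(2 :: 'a) = 0")
    case True
    have "(x * (x - 1)) ^ 2 = (6 * x ^ 5 + 15 * x ^ 4 + 20 * x ^ 3 + 15 * x ^ 2 + 6 * x)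
        - 2 * (3 * x ^ 5 + 7 * x ^ 4 + 11 * x ^ 3 + 7 * x ^ 2 + 3 * x)"
      by algebra
    then have "(x * (x - 1)) ^ 2 = 0" unfolding expand True by simp
    then show ?thesis by auto
  next
    case False
    then have "3 = (0 :: 'a)" using six by (simp only: mult_eq_0_iff simp_thms)
    have "2 * x ^ 3 = (6 * x ^ 5 + 15 * x ^ 4 + 20 * x ^ 3 + 15 * x ^ 2 + 6 * x)
        - 3 * (2 * x ^ 5 + 5 * x ^ 4 + 6 * x ^ 3 + 5 * x ^ 2 + 2 * x)"
      by algebra
    then have "2 * x ^ 3 = 0" unfolding expand \<open>3 = 0\<close> by simp
    then show ?thesis using False by auto
  qed
  then have "CARD('a) \<le> card {0, 1 :: 'a}" by (intro card_mono) auto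
  then show False using card by simp
qed

subsection \<open>Linear forms\<close>

interpretation form: vector_space_pair "(*s) :: 'a::field \<Rightarrow> 'a ^ 'n \<Rightarrow> 'a ^ 'n" "(*) :: 'a \<Rightarrow> 'a \<Rightarrow> 'a"
  ..

abbreviation linear_form :: "('a::field ^ 'n \<Rightarrow> 'a) \<Rightarrow> bool" where
  "linear_form h \<equiv> Vector_Spaces.linear (*s) (*) h"

lemma linear_form_exists:
  fixes e :: "nat \<Rightarrow> 'a::field ^ 'n"
  assumes "inj_on e I" "vec.independent (e ` I)"
  obtains h where "linear_form h" "\<And>i. i \<in> I \<Longrightarrow> h (e i) = w i"
proof -
  obtain h where "linear_form h" "\<forall>x\<in>e ` I. h x = w (the_inv_into I e x)"
    using form.linear_independent_extend[OF assms(2), of "\<lambda>x. w (the_inv_into I e x)"] by blast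
  then show thesis using that the_inv_into_f_f[OF assms(1)] by auto
qed

lemma linear_form_eq_0_on_span:
  assumes "linear_form h" "\<And>x. x \<in> B \<Longrightarrow> h x = 0" "x \<in> vec.span B"
  shows "h x = 0"
  by (rule form.linear_eq_0_on_span[OF assms])

text \<open>Thin \<open>B\<close> out to a basis of its span. Adding \<open>x\<close> keeps it
  independent, so the values 0 on the basis and 1 at \<open>x\<close> extend linearly.\<close>

lemma linear_form_separates:
  fixes x :: "'a::field ^ 'n"
  assumes "x \<notin> vec.span B"
  obtains h where "linear_form h" "\<And>y. y \<in> vec.span B \<Longrightarrow> h y = 0" "h x = 1"
proof -
  obtain C where C: "C \<subseteq> B" "vec.independent C" "B \<subseteq> vec.span C"
    using vec.maximal_independent_subset by blast
  have sp: "vec.span B = vec.span C"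
    using C by (simp add: subset_antisym vec.span_minimal vec.span_mono)
  have "vec.independent (insert x C)"
    using assms C(2) sp by (simp add: vec.independent_insertI)
  then obtain h where h: "linear_form h" "\<forall>y\<in>insert x C. h y = (if y = x then 1 else 0)"
    using form.linear_independent_extend[where f = "\<lambda>y. if y = x then 1 else 0"] by blast
  have "x \<notin> C" using assms sp vec.span_base by blast
  show thesis
  proof (rule that[OF h(1)])
    fix y assume "y \<in> vec.span B"
    then show "h y = 0"
      unfolding sp by (rule linear_form_eq_0_on_span[OF h(1), rotated]) (use h(2) \<open>x \<notin> C\<close> in auto)
  qed (use h(2) in auto)
qed

subsection \<open>Normal rational curves\<close>

text \<open>A representative vector of each point, so that linear forms can be evaluated along the
  curve.\<close>

definition nrc_vec :: "nat \<Rightarrow> (nat \<Rightarrow> 'a::field ^ 'n) \<Rightarrow> 'a option \<Rightarrow> 'a ^ 'n" where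
  "nrc_vec r b \<theta> = (case \<theta> of None \<Rightarrow> b r | Some t \<Rightarrow> \<Sum>i\<le>r. t ^ i *s b i)"

lemma nrc_point_eq_span: "nrc_point r b \<theta> = vec.span {nrc_vec r b \<theta>}"
  by (simp add: nrc_point_def nrc_vec_def split: option.split)

lemma nrc_vec_simps:
  "nrc_vec r b None = b r" "nrc_vec r b (Some t) = (\<Sum>i\<le>r. t ^ i *s b i)"
  by (simp_all add: nrc_vec_def)

lemma nrc_vec_Some_0: "nrc_vec r b (Some 0) = b 0"
  by (induction r) (simp_all add: nrc_vec_simps)

lemma nrc_vec_in_span: "nrc_vec r b \<theta> \<in> vec.span (b ` {..r})"
  by (cases \<theta>) (auto simp: nrc_vec_simps intro: vec.span_sum vec.span_scale vec.span_base)

lemma linear_form_nrc_vec: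
  assumes "linear_form h"
  shows "h (nrc_vec r b (Some t)) = (\<Sum>i\<le>r. t ^ i * h (b i))"
  by (simp add: nrc_vec_simps form.linear_sum[OF assms] form.linear_scale[OF assms])

text \<open>Along the finite parameters a form is a polynomial of degree at most \<open>r\<close>
  with coefficients \<open>h (b i)\<close>, so a hyperplane not containing all \<open>b i\<close>
  meets the curve in at most \<open>r\<close> points.\<close>

lemma card_zeros_on_nrc_le:
  fixes h :: "'a::{field,finite} ^ 'n \<Rightarrow> 'a"
  assumes h: "linear_form h" and i: "i \<le> r" "h (b i) \<noteq> 0"
  shows "card {\<theta>. h (nrc_vec r b \<theta>) = 0} \<le> r"
proof -
  define p where "p = (\<Sum>i\<le>r. monom (h (b i)) i)"
  have coeff: "coeff p j = (if j \<le> r then h (b j) else 0)" for j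
    by (simp add: p_def coeff_sum if_distrib sum.delta cong: if_cong)
  have poly: "poly p t = h (nrc_vec r b (Some t))" for t
    by (simp add: p_def linear_form_nrc_vec[OF h] poly_sum poly_monom mult.commute)
  have "p \<noteq> 0" using coeff[of i] i by auto
  then have roots: "card {t. poly p t = 0} \<le> degree p" by (rule card_poly_roots_bound)
  have deg: "degree p \<le> r" by (rule degree_le) (simp add: coeff)
  let ?Z = "{\<theta>. h (nrc_vec r b \<theta>) = 0}"
  show ?thesis
  proof (cases "h (b r) = 0")
    case True
    \<comment> \<open>A zero at infinity is a vanishing coefficient of \<open>t ^ r\<close>; the
      lost degree pays for the extra zero.\<close>
    then have "degree p \<noteq> r" using \<open>p \<noteq> 0\<close> coeff[of r] leading_coeff_0_iff[of p] by auto
    have "?Z \<subseteq> insert None (Some ` {t. poly p t = 0})"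
    proof
      fix \<theta> assume "\<theta> \<in> ?Z"
      then show "\<theta> \<in> insert None (Some ` {t. poly p t = 0})" by (cases \<theta>) (auto simp: poly)
    qed
    then have "card ?Z \<le> card (insert None (Some ` {t. poly p t = 0}))"
      by (intro card_mono) auto
    also have "\<dots> = Suc (card {t. poly p t = 0})"
      by (subst card_insert_disjoint) (auto simp: card_image)
    finally show ?thesis using roots deg \<open>degree p \<noteq> r\<close> by simp
  next
    case False
    have "?Z \<subseteq> Some ` {t. poly p t = 0}"
    proof
      fix \<theta> assume "\<theta> \<in> ?Z"
      then show "\<theta> \<in> Some ` {t. poly p t = 0}"
        using False by (cases \<theta>) (auto simp: poly nrc_vec_simps)
    qed
    then have "card ?Z \<le> card (Some ` {t. poly p t = 0})"
      by (intro card_mono) auto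
    then show ?thesis using roots deg by (simp add: card_image)
  qed
qed

text \<open>Otherwise a form vanishing at all \<open>q + 1\<close> points of the curve but not at
  some \<open>b i\<close> would have more than \<open>r\<close> zeros.\<close>

lemma span_nrc_vec:
  fixes b :: "nat \<Rightarrow> 'a::{field,finite} ^ 'n"
  assumes "r \<le> CARD('a)"
  shows "vec.span (range (nrc_vec r b)) = vec.span (b ` {..r})"
proof (rule ccontr)
  let ?S = "range (nrc_vec r b)"
  assume "vec.span ?S \<noteq> vec.span (b ` {..r})"
  moreover have "vec.span ?S \<subseteq> vec.span (b ` {..r})"
    by (intro vec.span_minimal) (auto simp: nrc_vec_in_span)
  ultimately have "\<not> b ` {..r} \<subseteq> vec.span ?S"
    using vec.span_minimal[of "b ` {..r}" "vec.span ?S"] by auto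
  then obtain i where i: "i \<le> r" "b i \<notin> vec.span ?S" by auto
  obtain h where h: "linear_form h" "\<And>y. y \<in> vec.span ?S \<Longrightarrow> h y = 0" "h (b i) = 1"
    using linear_form_separates[OF i(2)] by blast
  have "{\<theta>. h (nrc_vec r b \<theta>) = 0} = UNIV" using h(2) vec.span_base by blast
  then have "CARD('a option) \<le> r"
    using card_zeros_on_nrc_le[OF h(1) i(1), of b] h(3) by simp
  then show False using assms by (simp add: card_UNIV_option)
qed

text \<open>The multiplicities make the form vanish at infinity only when that is asked for.\<close>

lemma linear_form_zeros_pair:
  fixes b :: "nat \<Rightarrow> 'a::field ^ 'n"
  assumes "2 \<le> r" "inj_on b {..r}" "vec.independent (b ` {..r})"
  obtains h where "linear_form h" "\<And>\<theta>. h (nrc_vec r b \<theta>) = 0 \<longleftrightarrow> \<theta> = \<theta>1 \<or> \<theta> = \<theta>2"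
proof -
  note * = that
  \<comment> \<open>The coefficients of \<open>p\<close> serve as values on the basis: finite zeros
    of the form are roots of \<open>p\<close>, and a zero at infinity is a vanishing coefficient at
    \<open>r\<close>.\<close>
  have form: thesis if p: "degree p \<le> r" "coeff p r = 0 \<longleftrightarrow> \<theta>1 = None \<or> \<theta>2 = None"
    "\<And>t. poly p t = 0 \<longleftrightarrow> \<theta>1 = Some t \<or> \<theta>2 = Some t" for p
  proof -
    obtain h where h: "linear_form h" "\<And>i. i \<in> {..r} \<Longrightarrow> h (b i) = coeff p i"
      using linear_form_exists[OF assms(2,3), of "coeff p"] by blast
    have "h (nrc_vec r b (Some t)) = poly p t" for t
    proof -
      have "poly p t = (\<Sum>i\<le>r. coeff p i * t ^ i)"
        unfolding poly_altdef by (rule sum.mono_neutral_left) (use p(1) in \<open>auto simp: coeff_eq_0\<close>)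
      then show ?thesis using h by (simp add: linear_form_nrc_vec mult.commute)
    qed
    then have "h (nrc_vec r b \<theta>) = 0 \<longleftrightarrow> \<theta> = \<theta>1 \<or> \<theta> = \<theta>2" for \<theta>
      using p(2,3) h(2) by (cases \<theta>) (auto simp: nrc_vec_simps)
    then show thesis by (rule *[OF h(1)])
  qed
  have deg2: "degree ([:- s, 1:] ^ (r - 1) * [:- t, 1:]) = r" for s t :: 'a
    using assms(1) by (subst degree_mult_eq) (simp_all add: degree_power_eq)
  have top: "coeff ([:- s, 1:] ^ (r - 1) * [:- t, 1:]) r \<noteq> 0" for s t :: 'a
  proof -
    have "[:- s, 1:] ^ (r - 1) * [:- t, 1:] \<noteq> 0"
      by (intro no_zero_divisors power_not_zero) simp_all
    then show ?thesis using leading_coeff_neq_0 deg2[of s t] by metis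
  qed
  \<comment> \<open>Degree \<open>r - 1\<close> leaves infinity as the second zero;
    \<open>2 \<le> r\<close> keeps the exponent positive, so \<open>s\<close> is a root.\<close>
  have mixed: "degree ([:- s, 1:] ^ (r - 1)) \<le> r" "coeff ([:- s, 1:] ^ (r - 1)) r = 0"
    "poly ([:- s, 1:] ^ (r - 1)) t = 0 \<longleftrightarrow> s = t" for s t :: 'a
    using assms(1) by (auto simp: degree_power_eq coeff_eq_0)
  show thesis
  proof (cases \<theta>1; cases \<theta>2)
    assume "\<theta>1 = None" "\<theta>2 = None"
    then show thesis using assms(1) by (intro form[of 1]) (auto simp: coeff_eq_0)
  next
    fix t assume "\<theta>1 = None" "\<theta>2 = Some t"
    then show thesis by (intro form[of "[:- t, 1:] ^ (r - 1)"]) (simp_all only: mixed, auto)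
  next
    fix s assume "\<theta>1 = Some s" "\<theta>2 = None"
    then show thesis by (intro form[of "[:- s, 1:] ^ (r - 1)"]) (simp_all only: mixed, auto)
  next
    fix s t assume *: "\<theta>1 = Some s" "\<theta>2 = Some t"
    show thesis
    proof (rule form[of "[:- s, 1:] ^ (r - 1) * [:- t, 1:]"])
      show "degree ([:- s, 1:] ^ (r - 1) * [:- t, 1:]) \<le> r" using deg2 by simp
      show "coeff ([:- s, 1:] ^ (r - 1) * [:- t, 1:]) r = 0 \<longleftrightarrow> \<theta>1 = None \<or> \<theta>2 = None"
        using top * by simp
      show "poly ([:- s, 1:] ^ (r - 1) * [:- t, 1:]) u = 0 \<longleftrightarrow> \<theta>1 = Some u \<or> \<theta>2 = Some u" for u
        using * assms(1) by auto
    qed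
  qed
qed

text \<open>Take a form whose two prescribed zeros coincide: it vanishes on the point
  \<open>\<theta>1\<close> and at no other parameter.\<close>

lemma nrc_vec_span_singleton_imp_eq:
  fixes b :: "nat \<Rightarrow> 'a::field ^ 'n"
  assumes "2 \<le> r" "inj_on b {..r}" "vec.independent (b ` {..r})"
    "nrc_vec r b \<theta>2 \<in> vec.span {nrc_vec r b \<theta>1}"
  shows "\<theta>2 = \<theta>1"
proof -
  obtain h where h: "linear_form h" "\<And>\<theta>. h (nrc_vec r b \<theta>) = 0 \<longleftrightarrow> \<theta> = \<theta>1 \<or> \<theta> = \<theta>1"
    using linear_form_zeros_pair[OF assms(1-3)] by blast
  have "h (nrc_vec r b \<theta>2) = 0"
    by (rule linear_form_eq_0_on_span[OF h(1) _ assms(4)]) (simp add: h(2))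
  then show ?thesis using h(2) by simp
qed

text \<open>Distinct parameters give independent vectors, and two independent vectors fill a span of
  two generators.\<close>

lemma secant_eq_span:
  fixes b :: "nat \<Rightarrow> 'a::field ^ 'n"
  assumes b: "2 \<le> r" "inj_on b {..r}" "vec.independent (b ` {..r})"
    and "\<theta>1 \<noteq> \<theta>2" "nrc_vec r b \<theta>1 \<in> vec.span {u, w}" "nrc_vec r b \<theta>2 \<in> vec.span {u, w}"
  shows "vec.span {u, w} = vec.span {nrc_vec r b \<theta>1, nrc_vec r b \<theta>2}"
proof -
  let ?x = "nrc_vec r b \<theta>1" and ?y = "nrc_vec r b \<theta>2"
  have y: "?y \<notin> vec.span {?x}" and x: "?x \<notin> vec.span {?y}"
    using nrc_vec_span_singleton_imp_eq[OF b] assms(4) by blast+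
  have ne: "?x \<noteq> 0" using x vec.span_zero by metis
  have "?x \<noteq> ?y" using x vec.span_base by (metis singletonI)
  have ind: "vec.independent {?y, ?x}"
    using y ne by (intro vec.independent_insertI) (auto simp: vec.independent_empty)
  have "vec.dim (vec.span {u, w}) \<le> card {u, w}"
    by (rule vec.dim_le_card) auto
  also have "\<dots> \<le> card {?y, ?x}" using \<open>?x \<noteq> ?y\<close> card_insert_le_m1[of 2 "{w}" u] by simp
  finally have "vec.span {u, w} \<subseteq> vec.span {?y, ?x}"
    by (rule vec.card_ge_dim_independent[OF _ ind, rotated]) (use assms(5,6) in simp)
  moreover have "vec.span {?y, ?x} \<subseteq> vec.span {u, w}"
    using assms(5,6) by (intro vec.span_minimal) auto
  ultimately show ?thesis by (simp add: insert_commute)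
qed

subsection \<open>Reparametrisation\<close>

text \<open>The inner coefficients form the adjugate matrix, so the composite is the determinant
  times the identity; infinity and the pole are treated apart.\<close>

lemma moebius_moebius_inverse:
  fixes A B C D :: "'a::field"
  assumes "A * D - B * C \<noteq> 0"
  shows "moebius A B C D (moebius D (- B) (- C) A \<theta>) = \<theta>"
proof (cases \<theta>)
  case None
  then show ?thesis using assms by (auto simp: moebius_def field_simps)
next
  case (Some t)
  show ?thesis
  proof (cases "- C * t + A = 0")
    case True
    then have "C \<noteq> 0" using assms by auto
    then have "A / C = t" using True by (simp add: field_simps)
    then show ?thesis using Some True \<open>C \<noteq> 0\<close> by (simp add: moebius_def)
  next
    case False
    let ?m = "- C * t + A"
    have den: "C * ((D * t + - B) / ?m) + D = (A * D - B * C) / ?m"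
      using False by (simp add: divide_simps) (simp add: algebra_simps)
    have num: "A * ((D * t + - B) / ?m) + B = (A * D - B * C) * t / ?m"
      using False by (simp add: divide_simps) (simp add: algebra_simps)
    have "moebius A B C D (Some ((D * t + - B) / ?m)) = Some t"
      unfolding moebius_def option.case den num using False assms by simp
    then show ?thesis using Some False by (simp add: moebius_def)
  qed
qed

lemma surj_PGL2: "\<phi> \<in> PGL2 \<Longrightarrow> surj \<phi>"
  unfolding PGL2_def by clarify (rule surjI, erule moebius_moebius_inverse)

text \<open>Inversion reaches infinity and a translation any finite parameter. This allows any
  generator to be moved to parameter 0.\<close>

lemma PGL2_maps_0_to:
  fixes \<theta> :: "'a::field option"
  obtains \<psi> where "\<psi> \<in> PGL2" "\<psi> (Some 0) = \<theta>"
proof (cases \<theta>)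
  case None
  have "moebius 0 1 1 0 \<in> PGL2" "moebius 0 1 1 0 (Some 0) = (None :: 'a option)"
    unfolding PGL2_def by (force, simp add: moebius_def)
  then show thesis using that None by blast
next
  case (Some t)
  have "moebius 1 t 0 1 \<in> PGL2" "moebius 1 t 0 1 (Some 0) = Some t"
    unfolding PGL2_def by (force, simp add: moebius_def)
  then show thesis using that Some by blast
qed

text \<open>Stated with bounds instead of exact degrees, so that it survives a vanishing leading
  coefficient such as \<open>c = 0\<close> in \<open>[:d, c:]\<close>.\<close>

lemma coeff_mult_at_degree_bounds:
  fixes p q :: "'a::comm_semiring_0 poly"
  assumes "degree p \<le> m" "degree q \<le> n"
  shows "coeff (p * q) (m + n) = coeff p m * coeff q n"
proof -
  have "coeff (p * q) (m + n) = (\<Sum>i\<le>m + n. coeff p i * coeff q (m + n - i))"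
    by (rule coeff_mult)
  also have "\<dots> = (\<Sum>i\<in>{m}. coeff p i * coeff q (m + n - i))"
  proof (rule sum.mono_neutral_right)
    show "\<forall>i\<in>{..m + n} - {m}. coeff p i * coeff q (m + n - i) = 0"
    proof
      fix i assume "i \<in> {..m + n} - {m}"
      then have "degree p < i \<or> degree q < m + n - i" using assms by auto
      then show "coeff p i * coeff q (m + n - i) = 0" by (auto simp: coeff_eq_0)
    qed
  qed auto
  finally show ?thesis by simp
qed

lemma degree_linear_power_le: "degree ([:d, c:] ^ n) \<le> n"
proof -
  have "degree [:d, c:] \<le> 1" by simp
  then have "degree [:d, c:] * n \<le> 1 * n" by (rule mult_le_mono1)
  then show ?thesis using order_trans[OF degree_power_le] unfolding mult_1 by blast
qed

lemma coeff_linear_power_top: "coeff ([:d, c:] ^ n) n = (c :: 'a::comm_semiring_1) ^ n"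
proof (induction n)
  case (Suc n)
  have "coeff ([:d, c:] * [:d, c:] ^ n) (1 + n) = coeff [:d, c:] 1 * coeff ([:d, c:] ^ n) n"
    by (rule coeff_mult_at_degree_bounds) (simp_all add: degree_linear_power_le)
  then show ?case using Suc by simp
qed simp

lemma span_scale_singleton:
  fixes v :: "'a::field ^ 'n"
  assumes "k \<noteq> 0"
  shows "vec.span {k *s v} = vec.span {v}"
proof
  show "vec.span {k *s v} \<subseteq> vec.span {v}"
    by (intro vec.span_minimal) (auto intro: vec.span_scale vec.span_base)
  have "inverse k *s (k *s v) \<in> vec.span {k *s v}"
    by (intro vec.span_scale vec.span_base) simp
  then show "vec.span {v} \<subseteq> vec.span {k *s v}"
    using assms by (intro vec.span_minimal) (auto simp: vec.scale_scale)
qed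

text \<open>The homogeneous parametrisation of the curve: the affine parameter is
  \<open>y / x\<close>, and \<open>x = 0\<close> is infinity.\<close>

definition nrc_hom :: "nat \<Rightarrow> (nat \<Rightarrow> 'a::field ^ 'n) \<Rightarrow> 'a \<Rightarrow> 'a \<Rightarrow> 'a ^ 'n" where
  "nrc_hom r b x y = (\<Sum>i\<le>r. (x ^ (r - i) * y ^ i) *s b i)"

lemma span_nrc_hom:
  assumes "x \<noteq> 0 \<or> y \<noteq> 0"
  shows "vec.span {nrc_hom r b x y} = nrc_point r b (if x = 0 then None else Some (y / x))"
proof (cases "x = 0")
  case True
  have "nrc_hom r b x y = (\<Sum>i\<in>{r}. (x ^ (r - i) * y ^ i) *s b i)"
    unfolding nrc_hom_def by (rule sum.mono_neutral_right) (auto simp: True)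
  then have "nrc_hom r b x y = y ^ r *s b r" by simp
  then show ?thesis using True assms by (simp add: nrc_point_def span_scale_singleton)
next
  case False
  have "nrc_hom r b x y = x ^ r *s (\<Sum>i\<le>r. (y / x) ^ i *s b i)"
    unfolding nrc_hom_def vec.scale_sum_right vec.scale_scale
    by (rule sum.cong) (use False in \<open>auto simp: power_diff power_divide\<close>)
  then show ?thesis using False by (simp add: nrc_point_def span_scale_singleton)
qed

text \<open>Substituting a fractional linear map into the homogeneous form gives vectors polynomial
  in \<open>t\<close> of degree at most \<open>r\<close>; their coefficient vectors are the new
  \<open>b'\<close>.\<close>

lemma nrc_reparametrise:
  fixes b :: "nat \<Rightarrow> 'a::{field,finite} ^ 'n"
  assumes \<phi>: "\<phi> \<in> PGL2" and r: "r \<le> CARD('a)"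
  obtains b' where "\<And>\<theta>. nrc_point r b (\<phi> \<theta>) = nrc_point r b' \<theta>"
    "vec.span (b' ` {..r}) = vec.span (b ` {..r})"
proof -
  obtain A B C D where det: "A * D - B * C \<noteq> 0" and phi: "\<phi> = moebius A B C D"
    using \<phi> by (auto simp: PGL2_def)
  \<comment> \<open>\<open>P i\<close> is the coordinate at \<open>b i\<close> of
    \<open>nrc_hom\<close> for \<open>x = C t + D\<close> and \<open>y = A t + B\<close>.\<close>
  define P where "P i = [:D, C:] ^ (r - i) * [:B, A:] ^ i" for i
  define b' where "b' j = (\<Sum>i\<le>r. coeff (P i) j *s b i)" for j
  have degP: "degree (P i) \<le> r" if "i \<le> r" for i
  proof -
    have "degree (P i) \<le> (r - i) + i"
      unfolding P_def
      by (rule order_trans[OF degree_mult_le add_mono[OF degree_linear_power_le degree_linear_power_le]])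
    then show ?thesis using that by simp
  qed
  have topP: "coeff (P i) r = C ^ (r - i) * A ^ i" if "i \<le> r" for i
  proof -
    have "coeff (P i) ((r - i) + i) = C ^ (r - i) * A ^ i"
      unfolding P_def
      by (subst coeff_mult_at_degree_bounds) (auto simp: degree_linear_power_le coeff_linear_power_top)
    then show ?thesis using that by simp
  qed
  have polyP: "poly (P i) t = (\<Sum>j\<le>r. t ^ j * coeff (P i) j)" if "i \<le> r" for i t
    unfolding poly_altdef mult.commute[of "coeff _ _"]
    by (rule sum.mono_neutral_left) (use degP[OF that] in \<open>auto simp: coeff_eq_0\<close>)
  \<comment> \<open>At infinity only the coefficients of \<open>t ^ r\<close> remain, and they are
    the coordinates at \<open>(C, A)\<close>.\<close>
  have inf: "nrc_vec r b' None = nrc_hom r b C A"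
    by (simp add: nrc_vec_simps nrc_hom_def b'_def topP)
  have fin: "nrc_vec r b' (Some t) = nrc_hom r b (C * t + D) (A * t + B)" for t
  proof -
    have "nrc_vec r b' (Some t) = (\<Sum>i\<le>r. \<Sum>j\<le>r. (t ^ j * coeff (P i) j) *s b i)"
      unfolding nrc_vec_simps b'_def vec.scale_sum_right vec.scale_scale by (rule sum.swap)
    also have "\<dots> = (\<Sum>i\<le>r. poly (P i) t *s b i)"
      by (rule sum.cong) (simp_all add: polyP vec.scale_sum_left)
    finally show ?thesis by (simp add: nrc_hom_def P_def algebra_simps)
  qed
  have eq: "nrc_point r b (\<phi> \<theta>) = nrc_point r b' \<theta>" for \<theta>
  proof (cases \<theta>)
    case None
    have "C \<noteq> 0 \<or> A \<noteq> 0" using det by auto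
    then show ?thesis
      using None by (simp add: phi moebius_def nrc_point_eq_span[of r b'] inf span_nrc_hom)
  next
    case (Some t)
    have "C * t + D \<noteq> 0 \<or> A * t + B \<noteq> 0"
    proof (rule ccontr)
      assume "\<not> ?thesis"
      then have "C * t + D = 0" "A * t + B = 0" by auto
      moreover have "A * D - B * C = A * (C * t + D) - C * (A * t + B)" by (simp add: algebra_simps)
      ultimately show False using det by simp
    qed
    then show ?thesis
      using Some by (simp add: phi moebius_def nrc_point_eq_span[of r b'] fin span_nrc_hom)
  qed
  have sp: "vec.span (range (nrc_vec r c)) = vec.span (\<Union>(range (nrc_point r c)))"
    for c :: "nat \<Rightarrow> 'a ^ 'n"
  proof
    show "vec.span (range (nrc_vec r c)) \<subseteq> vec.span (\<Union>(range (nrc_point r c)))"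
      by (intro vec.span_mono) (auto simp: nrc_point_eq_span intro: vec.span_base)
    show "vec.span (\<Union>(range (nrc_point r c))) \<subseteq> vec.span (range (nrc_vec r c))"
      by (intro vec.span_minimal UN_least vec.subspace_span)
        (simp add: nrc_point_eq_span vec.span_mono)
  qed
  \<comment> \<open>Surjectivity of \<open>\<phi>\<close> makes both parametrisations trace the same
    point set, whence the equal spans.\<close>
  have "range (nrc_point r b') = nrc_point r b ` range \<phi>"
    unfolding image_image eq ..
  then have "range (nrc_point r b') = range (nrc_point r b)"
    using surj_PGL2[OF \<phi>] by simp
  then have "vec.span (b' ` {..r}) = vec.span (b ` {..r})"
    using sp[of b] sp[of b'] span_nrc_vec[OF r] by metis
  then show thesis using that eq by blast
qed

subsection \<open>Generators of the surface\<close>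

text \<open>The normalised situation: corresponding points share a parameter and the suspect
  generator has parameter 0. Being a secant, it lies in the span of the curve.\<close>

lemma no_secant_generator:
  fixes a b c :: "nat \<Rightarrow> 'a::{field,finite} ^ 7"
  assumes q: "7 \<le> CARD('a)"
    and span_ab: "vec.span (a ` {..2} \<union> b ` {..3}) = UNIV"
    and r: "2 \<le> r" "r \<le> 5"
    and c: "inj_on c {..r}" "vec.independent (c ` {..r})"
    and on: "\<And>\<theta>. \<exists>\<tau>. nrc_vec r c \<theta> \<in> vec.span {nrc_vec 2 a \<tau>, nrc_vec 3 b \<tau>}"
    and secant: "\<theta>1 \<noteq> \<theta>2" "nrc_vec r c \<theta>1 \<in> vec.span {a 0, b 0}"
      "nrc_vec r c \<theta>2 \<in> vec.span {a 0, b 0}"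
  shows False
proof -
  define U where "U = vec.span (c ` {..r})"
  define l where "l = vec.span {a 0, b 0}"
  \<comment> \<open>Both bases in one list: indices 0 to 2 belong to the conic, 3 to 6 to the
    cubic.\<close>
  define e where "e i = (if i \<le> 2 then a i else b (i - 3))" for i
  have l_eq: "l = vec.span {nrc_vec r c \<theta>1, nrc_vec r c \<theta>2}"
    unfolding l_def by (rule secant_eq_span[OF r(1) c secant])
  have "l \<subseteq> U"
    unfolding l_eq U_def by (intro vec.span_minimal) (simp_all add: nrc_vec_in_span)
  then have a0: "a 0 \<in> U" and b0: "b 0 \<in> U"
    unfolding l_def by (auto intro: vec.span_base)
  \<comment> \<open>This form certifies that the secant carries no third point of the curve.\<close>
  obtain h0 where h0: "linear_form h0" "\<And>\<theta>. h0 (nrc_vec r c \<theta>) = 0 \<longleftrightarrow> \<theta> = \<theta>1 \<or> \<theta> = \<theta>2"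
    using linear_form_zeros_pair[OF r(1) c] by blast
  have on_l: "\<theta> = \<theta>1 \<or> \<theta> = \<theta>2" if "nrc_vec r c \<theta> \<in> l" for \<theta>
  proof -
    have "h0 (nrc_vec r c \<theta>) = 0"
      by (rule linear_form_eq_0_on_span[OF h0(1) _ that[unfolded l_eq]]) (auto simp: h0(2))
    then show ?thesis using h0(2) by simp
  qed

  have e_image: "e ` {..<7} = a ` {..2} \<union> b ` {..3}"
  proof
    show "e ` {..<7} \<subseteq> a ` {..2} \<union> b ` {..3}" by (auto simp: e_def)
    have "a i = e i" if "i \<le> 2" for i using that by (simp add: e_def)
    moreover have "b i = e (i + 3)" for i by (simp add: e_def)
    ultimately show "a ` {..2} \<union> b ` {..3} \<subseteq> e ` {..<7}" by force
  qed
  have dim7: "vec.dim (UNIV :: ('a ^ 7) set) = 7" by (simp only: vec_dim_card) simp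
  have "7 \<le> card (e ` {..<7})"
    using vec.dim_le_card[of UNIV "e ` {..<7}"] span_ab dim7 by (simp add: e_image)
  moreover have "card (e ` {..<7}) \<le> 7" using card_image_le[of "{..<7}" e] by simp
  ultimately have card_e: "card (e ` {..<7}) = 7" by simp
  then have inj_e: "inj_on e {..<7}" by (intro eq_card_imp_inj_on) simp_all
  have ind_e: "vec.independent (e ` {..<7})"
    by (rule vec.card_le_dim_spanning[of _ UNIV]) (use card_e dim7 span_ab e_image in auto)

  \<comment> \<open>A form through the generator with parameter 0 is divisible by the parameter; the quotient
    is again a linear form and vanishes on the curve away from that generator.\<close>
  have shift: "\<exists>h'. linear_form h' \<and> (\<forall>y\<in>U. h' y = 0) \<and>
      (\<forall>i<2. h' (a i) = h (a (Suc i))) \<and> (\<forall>i<3. h' (b i) = h (b (Suc i)))"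
    if h: "linear_form h" "\<forall>y\<in>U. h y = 0" for h
  proof -
    \<comment> \<open>Division by \<open>t\<close> moves each coefficient down one index. Indices 2
      and 6 end the two blocks, so 0 is filled in there.\<close>
    obtain h' where h': "linear_form h'"
      and h'e: "\<And>i. i \<in> {..<7} \<Longrightarrow> h' (e i) = (if i = 2 \<or> i = 6 then 0 else h (e (Suc i)))"
      using linear_form_exists[OF inj_e ind_e, of "\<lambda>i. if i = 2 \<or> i = 6 then 0 else h (e (Suc i))"]
      by blast
    have h'a: "h' (a 0) = h (a 1)" "h' (a 1) = h (a 2)" "h' (a 2) = 0"
      using h'e[of 0] h'e[of 1] h'e[of 2] by (simp_all add: e_def numeral_2_eq_2)
    have h'b: "h' (b 0) = h (b 1)" "h' (b 1) = h (b 2)" "h' (b 2) = h (b 3)" "h' (b 3) = 0"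
      using h'e[of 3] h'e[of 4] h'e[of 5] h'e[of 6] by (simp_all add: e_def)
    have ab0: "h (a 0) = 0" "h (b 0) = 0" using h(2) a0 b0 by auto
    have sum2: "(\<Sum>i\<le>2. f i) = f 0 + f 1 + f 2" for f :: "nat \<Rightarrow> 'a"
      by (simp add: eval_nat_numeral)
    have sum3: "(\<Sum>i\<le>3. f i) = f 0 + f 1 + f 2 + f 3" for f :: "nat \<Rightarrow> 'a"
      by (simp add: eval_nat_numeral)
    have quot: "h (nrc_vec 2 a (Some t)) = t * h' (nrc_vec 2 a (Some t))"
      "h (nrc_vec 3 b (Some t)) = t * h' (nrc_vec 3 b (Some t))" for t
      unfolding linear_form_nrc_vec[OF h(1)] linear_form_nrc_vec[OF h'] sum2 sum3 h'a h'b ab0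
      by (simp_all add: algebra_simps power2_eq_square power3_eq_cube)
    have off_l: "h' (nrc_vec r c \<theta>) = 0" if "nrc_vec r c \<theta> \<notin> l" for \<theta>
    proof -
      obtain \<tau> where \<tau>: "nrc_vec r c \<theta> \<in> vec.span {nrc_vec 2 a \<tau>, nrc_vec 3 b \<tau>}"
        using on by blast
      show ?thesis
      proof (cases \<tau>)
        \<comment> \<open>The generator at infinity is spanned by \<open>a 2\<close> and
          \<open>b 3\<close>, where \<open>h'\<close> was set to 0.\<close>
        case None
        then show ?thesis
          using linear_form_eq_0_on_span[OF h' _ \<tau>] h'a(3) h'b(4) by (auto simp: nrc_vec_simps)
      next
        case (Some t)
        then have "t \<noteq> 0" using that \<tau> by (auto simp: l_def nrc_vec_Some_0)
        obtain k m where km: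
          "nrc_vec r c \<theta> = k *s nrc_vec 2 a (Some t) + m *s nrc_vec 3 b (Some t)"
          using \<tau> Some by (auto simp: vec.span_insert vec.span_singleton algebra_simps)
        have "h (nrc_vec r c \<theta>) = t * h' (nrc_vec r c \<theta>)"
          unfolding km
          by (simp add: form.linear_add[OF h(1)] form.linear_scale[OF h(1)]
              form.linear_add[OF h'] form.linear_scale[OF h'] quot algebra_simps)
        moreover have "h (nrc_vec r c \<theta>) = 0"
          using h(2) nrc_vec_in_span by (auto simp: U_def)
        ultimately show ?thesis using \<open>t \<noteq> 0\<close> by simp
      qed
    qed
    have "h' (c i) = 0" if i: "i \<le> r" for i
    proof (rule ccontr)
      assume "h' (c i) \<noteq> 0"
      then have Z: "card {\<theta>. h' (nrc_vec r c \<theta>) = 0} \<le> r"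
        by (rule card_zeros_on_nrc_le[OF h' i])
      \<comment> \<open>The count is at most \<open>2 + 5 = 7\<close> parameters against
        \<open>q + 1 \<ge> 8\<close>.\<close>
      have "(UNIV :: 'a option set) \<subseteq> {\<theta>1, \<theta>2} \<union> {\<theta>. h' (nrc_vec r c \<theta>) = 0}"
        using on_l off_l by blast
      then have "CARD('a option) \<le> card ({\<theta>1, \<theta>2} \<union> {\<theta>. h' (nrc_vec r c \<theta>) = 0})"
        by (intro card_mono) auto
      also have "\<dots> \<le> card {\<theta>1, \<theta>2} + card {\<theta>. h' (nrc_vec r c \<theta>) = 0}"
        by (rule card_Un_le)
      finally show False using Z q r(2) secant(1) by (simp add: card_UNIV_option)
    qed
    then have "\<forall>y\<in>U. h' y = 0"
      unfolding U_def using linear_form_eq_0_on_span[OF h', of "c ` {..r}"] by auto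
    moreover have "\<forall>i<2. h' (a i) = h (a (Suc i))" "\<forall>i<3. h' (b i) = h (b (Suc i))"
      using h'a h'b by (auto simp: less_Suc_eq eval_nat_numeral)
    ultimately show ?thesis using h' by blast
  qed
  \<comment> \<open>The value at index \<open>Suc i\<close> is the value at \<open>i\<close> of the
    quotient form, which again vanishes on \<open>U\<close>; the start is \<open>a 0\<close> in
    \<open>U\<close>.\<close>
  have vanish_a: "linear_form h \<Longrightarrow> \<forall>y\<in>U. h y = 0 \<Longrightarrow> i \<le> 2 \<Longrightarrow> h (a i) = 0" for h i
  proof (induction i arbitrary: h)
    case (Suc i)
    then show ?case using shift[of h] by (metis Suc_le_eq less_imp_le)
  qed (use a0 in auto)
  have vanish_b: "linear_form h \<Longrightarrow> \<forall>y\<in>U. h y = 0 \<Longrightarrow> i \<le> 3 \<Longrightarrow> h (b i) = 0" for h i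
  proof (induction i arbitrary: h)
    case (Suc i)
    then show ?case using shift[of h] by (metis Suc_le_eq less_imp_le)
  qed (use b0 in auto)

  \<comment> \<open>As \<open>r + 1 \<le> 6 < 7\<close>, some form is 0 on \<open>U\<close> and 1 at
    a point outside, yet it vanishes on a spanning set.\<close>
  have "vec.dim U \<le> card (c ` {..r})" unfolding U_def by (rule vec.dim_le_card) auto
  also have "\<dots> \<le> 6" using card_image_le[of "{..r}" c] r(2) by simp
  finally have "U \<noteq> UNIV" using dim7 by auto
  then obtain x where x: "x \<notin> vec.span (c ` {..r})" unfolding U_def by auto
  obtain h where h: "linear_form h" "\<And>y. y \<in> vec.span (c ` {..r}) \<Longrightarrow> h y = 0" "h x = 1"
    using linear_form_separates[OF x] by blast
  have "h x = 0"
    by (rule linear_form_eq_0_on_span[OF h(1), of "a ` {..2} \<union> b ` {..3}"])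
      (use vanish_a[OF h(1)] vanish_b[OF h(1)] h(2) span_ab in \<open>auto simp: U_def\<close>)
  then show False using h(3) by simp
qed

lemma span_nrc_points_Un:
  "vec.span (nrc_point r a \<theta> \<union> nrc_point s b \<tau>) = vec.span {nrc_vec r a \<theta>, nrc_vec s b \<tau>}"
  unfolding nrc_point_eq_span
proof
  let ?x = "nrc_vec r a \<theta>" and ?y = "nrc_vec s b \<tau>"
  show "vec.span (vec.span {?x} \<union> vec.span {?y}) \<subseteq> vec.span {?x, ?y}"
    by (intro vec.span_minimal Un_least vec.subspace_span vec.span_mono) auto
  show "vec.span {?x, ?y} \<subseteq> vec.span (vec.span {?x} \<union> vec.span {?y})"
    by (intro vec.span_mono) (auto intro: vec.span_base)
qed

text \<open>The dimension formula gives \<open>3 + 4 - 0 = 7\<close>.\<close>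

lemma span_Un_bases_eq_UNIV:
  fixes a b :: "nat \<Rightarrow> 'a::field ^ 7"
  assumes "proj_subspace 2 \<alpha>" "proj_subspace 3 S" "\<alpha> \<inter> S = {0}"
    "coordinate_basis 2 a \<alpha>" "coordinate_basis 3 b S"
  shows "vec.span (a ` {..2} \<union> b ` {..3}) = UNIV"
proof -
  have sub: "vec.subspace \<alpha>" "vec.subspace S" "vec.dim \<alpha> = 3" "vec.dim S = 4"
    using assms(1,2) by (auto simp: proj_subspace_def)
  have sp: "vec.span (a ` {..2}) = \<alpha>" "vec.span (b ` {..3}) = S"
    using assms(4,5) by (auto simp: coordinate_basis_def)
  have "vec.dim {x + y |x y. x \<in> \<alpha> \<and> y \<in> S} + vec.dim (\<alpha> \<inter> S) = 7"
    using vec.dim_sums_Int[OF sub(1,2)] sub(3,4) by simp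
  then have "vec.dim (vec.span (a ` {..2} \<union> b ` {..3})) = 7"
    unfolding vec.span_Un sp assms(3) by simp
  then have "vec.dim (a ` {..2} \<union> b ` {..3}) = 7" by simp
  then show ?thesis by (subst vec.dim_eq_full[symmetric]) (simp only: vec.dimension_def card_cart_basis, simp)
qed

theorem theorem2p9:
  fixes V G N :: "('a::{field,finite} ^ 7) set set" and r :: nat
  assumes "CARD('a) \<ge> 6"
    and "ruled_quintic_surface V G"
    and "r \<in> {3, 4, 5}"
    and "dim_nrc r N"
    and "N \<subseteq> V"
  shows "\<forall>g\<in>G. \<exists>!P. P \<in> N \<and> P \<in> points_on g"
proof -
  have q: "7 \<le> CARD('a)" using assms(1) finite_field_card_ne_6[where 'a = 'a] by simp
  have r: "2 \<le> r" "r \<le> 5" using assms(3) by auto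
  obtain \<alpha> S a b \<phi> where surf: "proj_subspace 2 \<alpha>" "proj_subspace 3 S" "\<alpha> \<inter> S = {0}"
      "coordinate_basis 2 a \<alpha>" "coordinate_basis 3 b S" and \<phi>: "\<phi> \<in> PGL2"
    and G: "G = {vec.span (nrc_point 2 a \<theta> \<union> nrc_point 3 b (\<phi> \<theta>)) |\<theta>. True}"
    and V: "V = (\<Union>g\<in>G. points_on g)"
    using assms(2) unfolding ruled_quintic_surface_def by blast
  obtain c where c: "inj_on c {..r}" "vec.independent (c ` {..r})" and N: "N = range (nrc_point r c)"
    using assms(4) unfolding dim_nrc_def coordinate_basis_def by blast
  \<comment> \<open>Absorbing \<open>\<phi>\<close> into the coordinates of the cubic gives
    corresponding points the same parameter.\<close>
  obtain b1 where b1: "\<And>\<theta>. nrc_point 3 b (\<phi> \<theta>) = nrc_point 3 b1 \<theta>"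
    and span_b1: "vec.span (b1 ` {..3}) = vec.span (b ` {..3})"
    using nrc_reparametrise[OF \<phi>, of 3 b] q by auto
  have G1: "G = range (\<lambda>\<theta>. vec.span (nrc_point 2 a \<theta> \<union> nrc_point 3 b1 \<theta>))"
    unfolding G b1 by auto
  have at_most_one: "\<theta>1 = \<theta>2"
    if g: "g \<in> G" "nrc_point r c \<theta>1 \<subseteq> g" "nrc_point r c \<theta>2 \<subseteq> g" for g \<theta>1 \<theta>2
  proof (rule ccontr)
    assume ne: "\<theta>1 \<noteq> \<theta>2"
    obtain \<theta>0 where \<theta>0: "g = vec.span (nrc_point 2 a \<theta>0 \<union> nrc_point 3 b1 \<theta>0)"
      using g(1) G1 by blast
    \<comment> \<open>The same \<open>\<psi>\<close> acts on both curves, so the matching of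
      parameters is kept while \<open>g\<close> moves to parameter 0.\<close>
    obtain \<psi> where \<psi>: "\<psi> \<in> PGL2" "\<psi> (Some 0) = \<theta>0" by (rule PGL2_maps_0_to)
    obtain a2 where a2: "\<And>\<theta>. nrc_point 2 a (\<psi> \<theta>) = nrc_point 2 a2 \<theta>"
      and span_a2: "vec.span (a2 ` {..2}) = vec.span (a ` {..2})"
      using nrc_reparametrise[OF \<psi>(1), of 2 a] q by auto
    obtain b2 where b2: "\<And>\<theta>. nrc_point 3 b1 (\<psi> \<theta>) = nrc_point 3 b2 \<theta>"
      and span_b2: "vec.span (b2 ` {..3}) = vec.span (b1 ` {..3})"
      using nrc_reparametrise[OF \<psi>(1), of 3 b1] q by auto
    have gen: "vec.span (nrc_point 2 a (\<psi> \<tau>) \<union> nrc_point 3 b1 (\<psi> \<tau>)) =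
        vec.span {nrc_vec 2 a2 \<tau>, nrc_vec 3 b2 \<tau>}" for \<tau>
      unfolding a2 b2 by (rule span_nrc_points_Un)
    have vec_in: "nrc_vec r c \<theta> \<in> g'" if "nrc_point r c \<theta> \<subseteq> g'" for \<theta> g'
      using that vec.span_base unfolding nrc_point_eq_span by blast
    have g0: "g = vec.span {a2 0, b2 0}"
      using gen[of "Some 0"] unfolding \<psi>(2) \<theta>0 nrc_vec_Some_0 .
    have "\<exists>\<tau>. nrc_vec r c \<theta> \<in> vec.span {nrc_vec 2 a2 \<tau>, nrc_vec 3 b2 \<tau>}" for \<theta>
    proof -
      have "nrc_point r c \<theta> \<in> V" using assms(5) N by auto
      then obtain g' where g': "g' \<in> G" "nrc_point r c \<theta> \<subseteq> g'"
        unfolding V points_on_def by blast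
      then obtain \<theta>' where "g' = vec.span (nrc_point 2 a \<theta>' \<union> nrc_point 3 b1 \<theta>')"
        using G1 by blast
      moreover obtain \<tau> where "\<theta>' = \<psi> \<tau>" using surj_PGL2[OF \<psi>(1)] by blast
      ultimately show ?thesis using gen vec_in[OF g'(2)] by auto
    qed
    moreover have "vec.span (a2 ` {..2} \<union> b2 ` {..3}) = UNIV"
      using span_Un_bases_eq_UNIV[OF surf] span_a2 span_b2 span_b1 by (simp add: vec.span_Un)
    ultimately show False
      using no_secant_generator[OF q _ r c _ ne] vec_in[OF g(2)] vec_in[OF g(3)] unfolding g0
      by blast
  qed
  \<comment> \<open>Choosing a generator through each of the \<open>q + 1\<close> curve points is
    injective, and there are at most \<open>q + 1\<close> generators, so each of them is
    chosen.\<close>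
  have "\<forall>\<theta>. \<exists>g\<in>G. nrc_point r c \<theta> \<in> points_on g" using assms(5) unfolding N V by blast
  then obtain gen where gen: "\<And>\<theta>. gen \<theta> \<in> G" "\<And>\<theta>. nrc_point r c \<theta> \<in> points_on (gen \<theta>)"
    by metis
  have "inj gen"
  proof
    fix \<theta>1 \<theta>2 assume "gen \<theta>1 = gen \<theta>2"
    then show "\<theta>1 = \<theta>2"
      using at_most_one[OF gen(1)[of \<theta>1]] gen(2)[of \<theta>1] gen(2)[of \<theta>2] by (simp add: points_on_def)
  qed
  moreover have "finite G" "card G \<le> CARD('a option)"
    unfolding G1 by (simp, rule card_image_le, simp)
  ultimately have range_gen: "range gen = G"
    using gen(1) by (intro card_seteq) (auto simp: card_image)
  show ?thesis
  proof
    fix g assume "g \<in> G"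
    then obtain \<theta> where \<theta>: "g = gen \<theta>" using range_gen by blast
    show "\<exists>!P. P \<in> N \<and> P \<in> points_on g"
    proof (rule ex1I[of _ "nrc_point r c \<theta>"])
      show "nrc_point r c \<theta> \<in> N \<and> nrc_point r c \<theta> \<in> points_on g" using gen(2) \<theta> N by auto
      show "P = nrc_point r c \<theta>" if "P \<in> N \<and> P \<in> points_on g" for P
        using that at_most_one[OF \<open>g \<in> G\<close>] gen(2)[of \<theta>] \<theta> N by (auto simp: points_on_def)
    qed
  qed
qed

end
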